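(* Assume (Pur) and (Erg) hold. Assume there exist $\tau\in(0,2)$ and $\delta>0$ such that $\int_{\mathrm M_k(\mathbb C)}\left(\|v\|^{2-\tau}+\|v\|^{2+\delta}\right)d\mu(v)<\infty$. Let $\alpha=1-\tau/2$. Then, for every $z\in\mathbb C$ with $\operatorname{Re}(z)\in(-\tau,\delta)$, the operator $\Gamma_z$ is a bounded endomorphism of $C^\alpha(\mathrm P(\mathbb C^k),\mathbb C)$, and the map $z\mapsto\Gamma_z$ (with values in the Banach space of bounded endomorphisms of $C^\alpha(\mathrm P(\mathbb C^k),\mathbb C)$) is analytic on the strip $\{z\in\mathbb C:\operatorname{Re}(z)\in(-\tau,\delta)\}$.
   Context: Let $k\in\mathbb N=\{1,2,\dots\}$ be fixed; $\mathbb C^k$ carries its canonical inner product and norm $\|\cdot\|$, and $\|v\|$ is the operator norm of a matrix $v$. $\mathrm P(\mathbb C^k)$ is the projective space with its Borel $\sigma$-algebra; $\hat x$ is the class of a nonzero vector $x$, and given $\hat x$, $x$ denotes a unit-norm representative. The metric is $d(\hat x,\hat y)=\sqrt{1-|\langle x,y\rangle|^2}$. For $v\in\mathrm M_k(\mathbb C)$ with $vx\ne0$, $v\cdot\hat x$ is the class of $vx$. For $0<\alpha\le1$, $C^\alpha(\mathrm P(\mathbb C^k),\mathbb C)$ is the Banach space of $\alpha$-Hölder functions with norm $\|f\|_\alpha=\|f\|_\infty+m_\alpha(f)$, $m_\alpha(f)=\sup_{\hat x\ne\hat y}|f(\hat x)-f(\hat y)|/d(\hat x,\hat y)^\alpha$.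 $\mu$ is a (not necessarily finite) Borel measure on $\mathrm M_k(\mathbb C)$ with $\int\|v\|^2d\mu(v)<\infty$ and $\int v^*v\,d\mu(v)=\mathrm{Id}_{\mathbb C^k}$. For $z$ in the strip, $\Gamma_zf(\hat x)=\int_{\mathrm M_k(\mathbb C)}f(v\cdot\hat x)e^{z\log\|vx\|}\|vx\|^2d\mu(v)$, with the integrand set to $0$ when $vx=0$. (Pur): any nonzero orthogonal projector $\pi$ on $\mathbb C^k$ such that, for every $n\in\mathbb N$, $\pi v_1^*\cdots v_n^*v_n\cdots v_1\pi\propto\pi$ (proportionality constant $0$ allowed) for $\mu^{\otimes n}$-almost every $(v_1,\dots,v_n)$, is of rank one. (Erg): there exists a unique minimal subspace $E\ne\{0\}$ of $\mathbb C^k$ such that $vE\subset E$ for $\mu$-almost every $v$. *)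

theory Defs
  imports "HOL-Analysis.Analysis"
begin

section \<open>The Hermitian structure of \<open>complex ^ 'k\<close>\<close>

text \<open>The library norm on \<^typ>\<open>complex ^ 'k\<close> is the canonical Hermitian norm, but the library
  inner product is only its real part.\<close>

definition cinner :: "complex ^ 'k \<Rightarrow> complex ^ 'k \<Rightarrow> complex" where
  "cinner x y = (\<Sum>i\<in>UNIV. cnj (x $ i) * y $ i)"

definition cadj :: "complex ^ 'k ^ 'k \<Rightarrow> complex ^ 'k ^ 'k" where
  "cadj A = (\<chi> i j. cnj (A $ j $ i))"

text \<open>The library norm on \<^typ>\<open>complex ^ 'k ^ 'k\<close> is the Frobenius norm; this is the operator norm.\<close>

definition opnorm_mat :: "complex ^ 'k ^ 'k \<Rightarrow> real" where
  "opnorm_mat A = onorm ((*v) A)"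

definition orth_projector :: "complex ^ 'k ^ 'k \<Rightarrow> bool" where
  "orth_projector P \<longleftrightarrow> P ** P = P \<and> cadj P = P"

section \<open>Projective space\<close>

definition proj_rel :: "complex ^ 'k \<Rightarrow> complex ^ 'k \<Rightarrow> bool" where
  "proj_rel x y \<longleftrightarrow> x \<noteq> 0 \<and> y \<noteq> 0 \<and> (\<exists>c. y = c *s x)"

lemma part_equivp_proj_rel: "part_equivp (proj_rel :: complex ^ 'k \<Rightarrow> _)"
proof (rule part_equivpI)
  have "proj_rel (1 :: complex ^ 'k) 1"
    unfolding proj_rel_def by (auto intro: exI[of _ 1])
  then show "\<exists>x::complex ^ 'k. proj_rel x x" by blast
  show "symp (proj_rel :: complex ^ 'k \<Rightarrow> _)"
  proof (rule sympI)
    fix x y :: "complex ^ 'k" assume "proj_rel x y"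
    then obtain c where c: "x \<noteq> 0" "y \<noteq> 0" "y = c *s x" by (auto simp: proj_rel_def)
    then have "c \<noteq> 0" by auto
    then have "x = inverse c *s y" using c by (simp add: vector_smult_assoc)
    then show "proj_rel y x" using c unfolding proj_rel_def by blast
  qed
  show "transp (proj_rel :: complex ^ 'k \<Rightarrow> _)"
    by (rule transpI) (auto simp: proj_rel_def vector_smult_assoc)
qed

quotient_type 'k proj = "complex ^ 'k" / partial: "proj_rel :: complex ^ 'k \<Rightarrow> complex ^ 'k \<Rightarrow> bool"
  morphisms proj_rep proj_class
  by (rule part_equivp_proj_rel)

definition unit_rep :: "'k::finite proj \<Rightarrow> complex ^ 'k" where
  "unit_rep p = (SOME x. norm x = 1 \<and> proj_class x = p)"

lemma proj_class_eq_iff: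
  assumes "x \<noteq> 0" "y \<noteq> 0"
  shows "proj_class x = proj_class y \<longleftrightarrow> (\<exists>c. y = c *s x)"
proof -
  have refl: "proj_rel x x" "proj_rel y y"
    using assms unfolding proj_rel_def by (auto intro: exI[of _ 1])
  have "proj_class x = proj_class y \<longleftrightarrow> proj_rel x y"
    using Quotient_rel[OF Quotient_proj, of x y] refl by blast
  then show ?thesis using assms by (simp add: proj_rel_def)
qed

lemma norm_vector_smult: "norm (c *s x) = norm c * norm (x :: complex ^ 'k)"
  unfolding norm_vec_def
  by (simp add: norm_mult L2_set_right_distrib)

lemma proj_class_surj: "\<exists>x. x \<noteq> 0 \<and> proj_class x = p"
proof -
  have "proj_rel (proj_rep p) (proj_rep p)" "proj_class (proj_rep p) = p"
    using Quotient_rep_reflp[OF Quotient_proj] Quotient_abs_rep[OF Quotient_proj] by auto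
  then show ?thesis by (auto simp: proj_rel_def)
qed

lemma unit_rep: "norm (unit_rep p) = 1" "proj_class (unit_rep p) = p"
proof -
  obtain x where x: "x \<noteq> 0" "proj_class x = p" using proj_class_surj by blast
  let ?c = "complex_of_real (inverse (norm x))"
  have n: "norm (?c *s x) = 1" using x by (simp add: norm_vector_smult norm_inverse)
  then have "?c *s x \<noteq> 0" by (metis norm_zero zero_neq_one)
  then have "proj_class (?c *s x) = p" using x proj_class_eq_iff by metis
  then have "norm (unit_rep p) = 1 \<and> proj_class (unit_rep p) = p"
    unfolding unit_rep_def using n someI[of "\<lambda>x. norm x = 1 \<and> proj_class x = p"] by blast
  then show "norm (unit_rep p) = 1" "proj_class (unit_rep p) = p" by auto
qed

lemma unit_rep_nonzero: "unit_rep p \<noteq> 0"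
  using unit_rep(1)[of p] by auto

lemma unit_rep_proj_class:
  assumes "x \<noteq> 0"
  obtains c where "c \<noteq> 0" "unit_rep (proj_class x) = c *s x" "norm x = 1 \<Longrightarrow> norm c = 1"
proof -
  obtain c where c: "unit_rep (proj_class x) = c *s x"
    using proj_class_eq_iff[OF assms unit_rep_nonzero] unit_rep(2) by metis
  have "norm c * norm x = 1"
    using c unit_rep(1)[of "proj_class x"] norm_vector_smult by metis
  with c that show thesis by (metis mult_cancel_left1 mult_zero_left norm_zero mult.right_neutral zero_neq_one)
qed

text \<open>Rank-one projectors are used to obtain the triangle inequality:
  the distance below is their Frobenius distance divided by \<open>sqrt 2\<close>.\<close>

definition ketbra :: "complex ^ 'k \<Rightarrow> complex ^ 'k ^ 'k" where
  "ketbra x = (\<chi> i j. x $ i * cnj (x $ j))"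

lemma inner_ketbra: "ketbra x \<bullet> ketbra y = (norm (cinner x y))\<^sup>2"
proof -
  have "complex_of_real ((norm (cinner x y))\<^sup>2) = cnj (cinner x y) * cinner x y"
    by (metis complex_norm_square mult.commute)
  also have "\<dots> = (\<Sum>i\<in>UNIV. \<Sum>j\<in>UNIV. (x $ i * cnj (x $ j)) * cnj (y $ i * cnj (y $ j)))"
    by (simp add: cinner_def sum_product algebra_simps)
  finally have "(norm (cinner x y))\<^sup>2
      = Re (\<Sum>i\<in>UNIV. \<Sum>j\<in>UNIV. (x $ i * cnj (x $ j)) * cnj (y $ i * cnj (y $ j)))"
    by (metis Re_complex_of_real)
  also have "\<dots> = ketbra x \<bullet> ketbra y"
    unfolding inner_vec_def ketbra_def Re_sum
    by (intro sum.cong) (simp_all add: inner_complex_def algebra_simps)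
  finally show ?thesis by simp
qed

lemma cinner_self: "cinner x x = complex_of_real ((norm x)\<^sup>2)"
  by (simp add: cinner_def norm_vec_def L2_set_def sum_nonneg mult.commute[of "cnj _"]
      complex_norm_square[symmetric])

lemma dist_ketbra:
  assumes "norm x = 1" "norm y = 1"
  shows "sqrt (1 - (norm (cinner x y))\<^sup>2) = norm (ketbra x - ketbra y) / sqrt 2"
proof -
  have n: "ketbra x \<bullet> ketbra x = 1" "ketbra y \<bullet> ketbra y = 1"
    unfolding inner_ketbra using assms by (simp_all add: cinner_self)
  have "(norm (ketbra x - ketbra y))\<^sup>2 = 2 * (1 - ketbra x \<bullet> ketbra y)"
    unfolding power2_norm_eq_inner
    by (simp add: inner_diff inner_commute[of "ketbra y" "ketbra x"] n)
  then have "(norm (ketbra x - ketbra y))\<^sup>2 = 2 * (1 - (norm (cinner x y))\<^sup>2)"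
    by (simp only: inner_ketbra)
  then have "norm (ketbra x - ketbra y) = sqrt (2 * (1 - (norm (cinner x y))\<^sup>2))"
    by (metis norm_ge_zero real_sqrt_unique)
  then show ?thesis unfolding real_sqrt_mult by simp
qed

lemma ketbra_mult: "ketbra y *v x = cinner y x *s y"
  by (vector matrix_vector_mult_def ketbra_def cinner_def sum_distrib_left sum_distrib_right
      algebra_simps)

lemma ketbra_eqD:
  assumes "norm x = 1" "ketbra x = ketbra y"
  shows "\<exists>c. x = c *s y"
proof -
  have "x = ketbra x *v x" using assms(1) by (simp add: ketbra_mult cinner_self)
  also have "\<dots> = cinner y x *s y" unfolding assms(2) by (rule ketbra_mult)
  finally show ?thesis by blast
qed

instantiation proj :: (finite) metric_space
begin

definition dist_proj :: "'a proj \<Rightarrow> 'a proj \<Rightarrow> real" where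
  "dist_proj p q = sqrt (1 - (norm (cinner (unit_rep p) (unit_rep q)))\<^sup>2)"

definition uniformity_proj :: "('a proj \<times> 'a proj) filter" where
  "uniformity_proj = (INF e\<in>{0<..}. principal {(x, y). dist x y < e})"

definition open_proj :: "'a proj set \<Rightarrow> bool" where
  "open_proj U \<longleftrightarrow> (\<forall>x\<in>U. \<forall>\<^sub>F (x', y) in uniformity. x' = x \<longrightarrow> y \<in> U)"

instance
proof
  have d: "dist p q = norm (ketbra (unit_rep p) - ketbra (unit_rep q)) / sqrt 2" for p q :: "'a proj"
    unfolding dist_proj_def by (rule dist_ketbra) (rule unit_rep)+
  fix p q r :: "'a proj"
  show "dist p q = 0 \<longleftrightarrow> p = q"
  proof
    assume "dist p q = 0"
    then have "ketbra (unit_rep q) = ketbra (unit_rep p)" by (simp add: d)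
    then obtain c where "unit_rep q = c *s unit_rep p"
      using ketbra_eqD unit_rep(1) by blast
    then show "p = q"
      using proj_class_eq_iff[OF unit_rep_nonzero unit_rep_nonzero] unit_rep(2) by metis
  qed (simp add: d)
  have "norm (ketbra (unit_rep p) - ketbra (unit_rep q))
      \<le> norm (ketbra (unit_rep p) - ketbra (unit_rep r)) + norm (ketbra (unit_rep q) - ketbra (unit_rep r))"
    using norm_triangle_ineq4[of "ketbra (unit_rep p) - ketbra (unit_rep r)"
        "ketbra (unit_rep q) - ketbra (unit_rep r)"] by simp
  then show "dist p q \<le> dist p r + dist q r"
    by (simp add: d add_divide_distrib[symmetric] divide_right_mono)
qed (simp_all add: uniformity_proj_def open_proj_def)

end

lemma dist_proj_class:
  assumes "norm x = 1" "norm y = 1"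
  shows "dist (proj_class x) (proj_class y) = sqrt (1 - (norm (cinner x y))\<^sup>2)"
proof -
  have "x \<noteq> 0" "y \<noteq> 0" using assms by auto
  then obtain c d where "unit_rep (proj_class x) = c *s x" "norm c = 1"
    "unit_rep (proj_class y) = d *s y" "norm d = 1"
    using unit_rep_proj_class assms by metis
  moreover have "cinner (c *s x) (d *s y) = cnj c * d * cinner x y"
    by (simp add: cinner_def sum_distrib_left algebra_simps)
  ultimately show ?thesis by (simp add: dist_proj_def norm_mult)
qed

text \<open>Meaningful only if \<open>v *v unit_rep p \<noteq> 0\<close>.\<close>

definition proj_act :: "complex ^ 'k ^ 'k \<Rightarrow> 'k::finite proj \<Rightarrow> 'k proj" where
  "proj_act v p = proj_class (v *v unit_rep p)"

lemma proj_act_proj_class: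
  assumes "v *v x \<noteq> 0"
  shows "proj_act v (proj_class x) = proj_class (v *v x)"
proof -
  have "x \<noteq> 0" using assms by auto
  then obtain c where c: "c \<noteq> 0" "unit_rep (proj_class x) = c *s x"
    using unit_rep_proj_class by metis
  have "v *v (c *s x) = c *s (v *v x)"
    by (simp add: vec.scale)
  moreover have "c *s (v *v x) \<noteq> 0" using assms c by simp
  ultimately show ?thesis
    unfolding proj_act_def c(2) using proj_class_eq_iff[OF assms] by metis
qed

lemma norm_mult_unit_rep:
  assumes "norm x = 1"
  shows "norm (v *v unit_rep (proj_class x)) = norm (v *v x)"
proof -
  have "x \<noteq> 0" using assms by auto
  then obtain c where "norm c = 1" "unit_rep (proj_class x) = c *s x"
    using unit_rep_proj_class assms by metis
  then show ?thesis by (simp add: vec.scale norm_vector_smult)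
qed

section \<open>Hoelder functions and their bounded endomorphisms\<close>

text \<open>\<open>C\<^sup>\<alpha>\<close> depends on the real number \<open>\<alpha>\<close>, hence is a carrier set of functions with an explicit norm.
  Boundedness is automatic since the metric is bounded by 1.\<close>

definition holder_space :: "real \<Rightarrow> ('k::finite proj \<Rightarrow> complex) set" where
  "holder_space \<alpha> = {f. \<exists>C. \<forall>p q. norm (f p - f q) \<le> C * dist p q powr \<alpha>}"

text \<open>The inserted \<open>0\<close> matters only for \<open>CARD('k) = 1\<close>, where there are no pairs of distinct points.\<close>

definition holder_seminorm :: "real \<Rightarrow> ('k::finite proj \<Rightarrow> complex) \<Rightarrow> real" where
  "holder_seminorm \<alpha> f =
     Sup (insert 0 {norm (f p - f q) / dist p q powr \<alpha> | p q. p \<noteq> q})"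

definition holder_norm :: "real \<Rightarrow> ('k::finite proj \<Rightarrow> complex) \<Rightarrow> real" where
  "holder_norm \<alpha> f = (SUP p. norm (f p)) + holder_seminorm \<alpha> f"

type_synonym 'k fun_op = "('k proj \<Rightarrow> complex) \<Rightarrow> 'k proj \<Rightarrow> complex"

definition bounded_endo :: "real \<Rightarrow> 'k::finite fun_op \<Rightarrow> bool" where
  "bounded_endo \<alpha> T \<longleftrightarrow>
     (\<forall>f\<in>holder_space \<alpha>. T f \<in> holder_space \<alpha>) \<and>
     (\<forall>f\<in>holder_space \<alpha>. \<forall>g\<in>holder_space \<alpha>. T (\<lambda>p. f p + g p) = (\<lambda>p. T f p + T g p)) \<and>
     (\<forall>c. \<forall>f\<in>holder_space \<alpha>. T (\<lambda>p. c * f p) = (\<lambda>p. c * T f p)) \<and>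
     (\<exists>C. \<forall>f\<in>holder_space \<alpha>. holder_norm \<alpha> (T f) \<le> C * holder_norm \<alpha> f)"

text \<open>The operator norm; as for \<^const>\<open>onorm\<close>, meaningful only for bounded endomorphisms,
  and \<open>f = 0\<close> contributes \<open>0 / 0 = 0\<close>.\<close>

definition endo_norm :: "real \<Rightarrow> 'k::finite fun_op \<Rightarrow> real" where
  "endo_norm \<alpha> T = (SUP f\<in>holder_space \<alpha>. holder_norm \<alpha> (T f) / holder_norm \<alpha> f)"

text \<open>Analyticity with values in the bounded endomorphisms: local expansion in a power series
  with bounded endomorphisms as coefficients, converging in operator norm.\<close>

definition analytic_endo_on :: "real \<Rightarrow> (complex \<Rightarrow> 'k::finite fun_op) \<Rightarrow> complex set \<Rightarrow> bool" where
  "analytic_endo_on \<alpha> T S \<longleftrightarrow>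
     (\<forall>z\<in>S. bounded_endo \<alpha> (T z)) \<and>
     (\<forall>z\<^sub>0\<in>S. \<exists>r>0. ball z\<^sub>0 r \<subseteq> S \<and>
       (\<exists>A :: nat \<Rightarrow> 'k fun_op. (\<forall>n. bounded_endo \<alpha> (A n)) \<and>
         (\<forall>z\<in>ball z\<^sub>0 r.
           (\<lambda>N. endo_norm \<alpha> (\<lambda>f p. T z f p - (\<Sum>n<N. (z - z\<^sub>0) ^ n * A n f p))) \<longlonglongrightarrow> 0)))"

section \<open>The operators and the assumptions on the measure\<close>

definition Gamma_integrand ::
    "complex \<Rightarrow> ('k::finite proj \<Rightarrow> complex) \<Rightarrow> 'k proj \<Rightarrow> complex ^ 'k ^ 'k \<Rightarrow> complex" where
  "Gamma_integrand z f p v =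
     (if v *v unit_rep p = 0 then 0
      else f (proj_act v p) * exp (z * complex_of_real (ln (norm (v *v unit_rep p))))
             * complex_of_real ((norm (v *v unit_rep p))\<^sup>2))"

definition Gamma_op :: "(complex ^ 'k ^ 'k) measure \<Rightarrow> complex \<Rightarrow> 'k::finite fun_op" where
  "Gamma_op \<mu> z f p = (LINT v|\<mu>. Gamma_integrand z f p v)"

text \<open>\<open>mat_prod v n\<close> is \<open>v\<^sub>n \<cdots> v\<^sub>1\<close>, so that its adjoint is \<open>v\<^sub>1\<^sup>* \<cdots> v\<^sub>n\<^sup>*\<close>.\<close>

primrec mat_prod :: "(nat \<Rightarrow> complex ^ 'k ^ 'k) \<Rightarrow> nat \<Rightarrow> complex ^ 'k ^ 'k" where
  "mat_prod v 0 = mat 1"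
| "mat_prod v (Suc n) = v (Suc n) ** mat_prod v n"

text \<open>Sigma-finiteness of \<open>\<mu>\<close> is not assumed. When \<open>\<integral>\<parallel>v\<parallel>\<^sup>2 d\<mu> < \<infinity>\<close> it can fail only
  by \<open>\<mu> {0} = \<infinity>\<close>; then the product measure is still determined on the tuples of nonzero matrices, and
  the condition below holds trivially (with constant \<open>0\<close>) on all other tuples.\<close>

definition Pur :: "(complex ^ 'k ^ 'k) measure \<Rightarrow> bool" where
  "Pur \<mu> \<longleftrightarrow>
     (\<forall>P. orth_projector P \<and> P \<noteq> 0 \<and>
        (\<forall>n\<ge>1. AE v in PiM {1..n} (\<lambda>_. \<mu>).
           \<exists>c::complex. P ** cadj (mat_prod v n) ** mat_prod v n ** P = (\<chi> i j. c * P $ i $ j))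
      \<longrightarrow> rank P = 1)"

definition ae_invariant :: "(complex ^ 'k ^ 'k) measure \<Rightarrow> (complex ^ 'k) set \<Rightarrow> bool" where
  "ae_invariant \<mu> E \<longleftrightarrow> vec.subspace E \<and> E \<noteq> {0} \<and> (AE v in \<mu>. (*v) v ` E \<subseteq> E)"

definition Erg :: "(complex ^ 'k ^ 'k) measure \<Rightarrow> bool" where
  "Erg \<mu> \<longleftrightarrow> (\<exists>!E. ae_invariant \<mu> E \<and> (\<forall>F. ae_invariant \<mu> F \<and> F \<subseteq> E \<longrightarrow> F = E))"

end

theory Submission
  imports Defs
begin

text \<open>
  For a unit vector \<open>x\<close> representing \<open>p\<close>, the operator \<open>\<Gamma>\<^sub>z\<close> integrates \<open>f (v\<cdot>p)\<close> against \<open>\<parallel>v x\<parallel> powr (2 + z)\<close>.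
  Two facts about the action of \<open>v\<close> are needed: \<open>x \<mapsto> \<parallel>v x\<parallel>\<close> is Lipschitz for the projective
  distance with constant \<open>\<parallel>v\<parallel>\<close> (\<open>norm_mult_unit_rep_diff\<close>), and
  \<open>dist (v\<cdot>p) (v\<cdot>q) \<le> \<parallel>v\<parallel> dist p q / \<parallel>v x\<parallel>\<close> (\<open>dist_proj_act\<close>). Both come from projecting one unit
  representative orthogonally onto the line of the other. The second bound is singular where
  \<open>\<parallel>v x\<parallel>\<close> is small, but the singularity enters only to the power \<open>\<alpha>\<close>, and the factor
  \<open>\<parallel>v x\<parallel> powr (2 + Re z)\<close> more than compensates for it: \<open>2 + Re z > 2 - \<tau> = 2 * \<alpha>\<close>.

  This argument uses of \<open>\<parallel>v x\<parallel> powr (2 + z)\<close> only that, as a function \<open>g\<close> of \<open>L = ln \<parallel>v x\<parallel>\<close>, it and its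
  derivative are bounded by \<open>K * W (exp L)\<close> for the weight \<open>W t = t powr (2 - \<tau>) + t powr (2 + \<delta>)\<close>, whose integral
  against \<open>\<mu>\<close> at \<open>\<parallel>v\<parallel>\<close> is finite. It is therefore carried out for an arbitrary kernel \<open>g\<close>
  (\<open>kernel_integrand_holder\<close>, \<open>kernel_op_bounds\<close>), and it bounds the operator norm by a constant
  times \<open>K\<close>.

  Analyticity then reduces to estimates of scalar functions of \<open>L\<close>. Around a point \<open>z\<close> of the strip,
  \<open>exp ((2 + z + \<zeta>) L)\<close> is expanded in powers of \<open>\<zeta>\<close>; the coefficients
  \<open>exp ((2 + z) L) L ^ n / n!\<close> are again admissible kernels and define the coefficient operators. If \<open>r\<close> is at
  most the distance from \<open>z\<close> to the boundary of the strip and \<open>\<bar>\<zeta>\<bar> < r\<close>, the remainder of order \<open>N\<close> satisfies the kernel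
  bound with \<open>K\<close> proportional to \<open>(\<bar>\<zeta>\<bar> / r) ^ N\<close> (\<open>kernel_bound_exp_remainder\<close>), because the factor
  \<open>exp (r \<bar>L\<bar>)\<close> lost in the estimate is still covered by \<open>W\<close>. Hence the power series converges in operator norm.
\<close>

section \<open>How a matrix moves points of projective space\<close>

lemma inner_eq_Re_cinner: "x \<bullet> y = Re (cinner x y)"
  by (simp add: inner_vec_def cinner_def inner_complex_def)

lemma cinner_smult_right: "cinner x (c *s y) = c * cinner x y"
  by (simp add: cinner_def sum_distrib_left algebra_simps)

text \<open>Completing the square in \<open>c\<close>: the point of the line spanned by \<open>y\<close> that is closest to \<open>x\<close> is
  \<open>\<langle>y, x\<rangle> y\<close>, and its distance from \<open>x\<close> is the projective distance. The identity yields both the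
  lower bound (for every \<open>c\<close>) and the optimal choice of \<open>c\<close>.\<close>

lemma norm_diff_smult_sq:
  assumes "norm x = 1" "norm y = 1"
  shows "(norm (x - c *s y))\<^sup>2 = 1 - (norm (cinner x y))\<^sup>2 + (norm (c - cnj (cinner x y)))\<^sup>2"
proof -
  let ?k = "cinner x y"
  have "(norm (x - c *s y))\<^sup>2 = (norm x)\<^sup>2 - 2 * (x \<bullet> (c *s y)) + (norm (c *s y))\<^sup>2"
    by (simp add: power2_norm_eq_inner inner_diff inner_commute)
  also have "\<dots> = 1 - 2 * Re (c * ?k) + (norm c)\<^sup>2"
    using assms by (simp add: inner_eq_Re_cinner cinner_smult_right norm_vector_smult)
  also have "\<dots> = 1 - (norm ?k)\<^sup>2 + (norm (c - cnj ?k))\<^sup>2"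
    unfolding cmod_power2 by (simp add: algebra_simps power2_eq_square)
  finally show ?thesis .
qed

text \<open>The left-hand side is the distance from \<open>a\<close> to the line spanned by \<open>b\<close>. Because only one of the
  two vectors has to be normalised, images under a matrix can be compared without any control on
  the size of the second one.\<close>

lemma dist_proj_class_mult_norm_le:
  assumes "a \<noteq> 0" "b \<noteq> 0"
  shows "dist (proj_class a) (proj_class b) * norm a \<le> norm (a - c *s b)"
proof -
  define x where "x = complex_of_real (inverse (norm a)) *s a"
  define y where "y = complex_of_real (inverse (norm b)) *s b"
  have n: "norm x = 1" "norm y = 1"
    using assms by (simp_all add: x_def y_def norm_vector_smult norm_inverse)
  have a: "a = complex_of_real (norm a) *s x" and b: "b = complex_of_real (norm b) *s y"
    using assms by (simp_all add: x_def y_def vector_smult_assoc flip: of_real_mult)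
  have "x \<noteq> 0" "y \<noteq> 0" using n by auto
  then have cl: "proj_class a = proj_class x" "proj_class b = proj_class y"
    using assms a b proj_class_eq_iff by metis+
  define c' where "c' = c * complex_of_real (norm b) / complex_of_real (norm a)"
  have "dist (proj_class a) (proj_class b) \<le> norm (x - c' *s y)"
    unfolding cl dist_proj_class[OF n]
    by (rule real_le_lsqrt) (simp_all add: norm_diff_smult_sq[OF n])
  moreover have "a - c *s b = complex_of_real (norm a) *s (x - c' *s y)"
    using assms(1) a b unfolding c'_def
    by (metis (no_types, lifting) mult.commute nonzero_eq_divide_eq norm_eq_zero of_real_eq_0_iff
        vec.scale_right_diff_distrib vector_smult_assoc)
  then have "norm (a - c *s b) = norm (x - c' *s y) * norm a"
    by (simp only: norm_vector_smult norm_of_real abs_norm_cancel mult.commute)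
  ultimately show ?thesis by (simp add: mult_right_mono)
qed

text \<open>The orthogonal projection of one representative onto the line of the other. A matrix can be applied to this
  decomposition, which is how the two estimates on matrix actions below are obtained.\<close>

lemma unit_rep_decomposition:
  obtains c where "norm c \<le> 1" "norm (unit_rep p - c *s unit_rep q) = dist p q"
proof
  let ?k = "cinner (unit_rep p) (unit_rep q)"
  have sq: "(norm (unit_rep p - c *s unit_rep q))\<^sup>2 = 1 - (norm ?k)\<^sup>2 + (norm (c - cnj ?k))\<^sup>2" for c
    by (rule norm_diff_smult_sq) (rule unit_rep)+
  have "0 \<le> (norm (unit_rep p - cnj ?k *s unit_rep q))\<^sup>2" by simp
  then show "norm (cnj ?k) \<le> 1"
    unfolding sq by (simp add: abs_square_le_1)
  show "norm (unit_rep p - cnj ?k *s unit_rep q) = dist p q"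
    unfolding dist_proj_def by (rule real_sqrt_unique[symmetric]) (simp_all add: sq)
qed

lemma dist_proj_le_1: "dist p q \<le> (1::real)" for p q :: "'k::finite proj"
  by (simp add: dist_proj_def)

lemma norm_mult_le_opnorm: "norm (v *v x) \<le> opnorm_mat v * norm x"
  unfolding opnorm_mat_def by (rule onorm) (rule matrix_vector_mul_bounded_linear)

lemma opnorm_mat_nonneg: "0 \<le> opnorm_mat v"
  unfolding opnorm_mat_def by (rule onorm_pos_le) (rule matrix_vector_mul_bounded_linear)

lemma norm_mult_unit_rep_le: "norm (v *v unit_rep p) \<le> opnorm_mat v"
  using norm_mult_le_opnorm[of v "unit_rep p"] by (simp add: unit_rep)

text \<open>The bound \<open>norm c \<le> 1\<close> of the decomposition replaces an adjustment of phases, so the Lipschitz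
  constant is exactly the operator norm.\<close>

lemma norm_mult_unit_rep_diff:
  "norm (v *v unit_rep p) \<le> norm (v *v unit_rep q) + opnorm_mat v * dist p q"
proof -
  obtain c where c: "norm c \<le> 1" "norm (unit_rep p - c *s unit_rep q) = dist p q"
    by (rule unit_rep_decomposition)
  have "v *v unit_rep p = c *s (v *v unit_rep q) + v *v (unit_rep p - c *s unit_rep q)"
    by (simp add: matrix_vector_mult_diff_distrib vec.scale)
  also have "norm \<dots> \<le> norm c * norm (v *v unit_rep q) + norm (v *v (unit_rep p - c *s unit_rep q))"
    by (metis norm_triangle_ineq norm_vector_smult)
  also have "\<dots> \<le> 1 * norm (v *v unit_rep q) + opnorm_mat v * dist p q"
    using norm_mult_le_opnorm[of v "unit_rep p - c *s unit_rep q"] c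
    by (intro add_mono mult_right_mono) auto
  finally show ?thesis by simp
qed

text \<open>The projection onto a line becomes, after applying \<open>v\<close>, some point on the image line, which is at
  least as far from \<open>v x\<close> as the closest one. The loss \<open>1 / \<parallel>v x\<parallel>\<close> is unavoidable near the null
  space of \<open>v\<close>.\<close>

lemma dist_proj_act:
  assumes "v *v unit_rep p \<noteq> 0" "v *v unit_rep q \<noteq> 0"
  shows "dist (proj_act v p) (proj_act v q) * norm (v *v unit_rep p) \<le> opnorm_mat v * dist p q"
proof -
  obtain c where c: "norm c \<le> 1" "norm (unit_rep p - c *s unit_rep q) = dist p q"
    by (rule unit_rep_decomposition)
  have "dist (proj_act v p) (proj_act v q) * norm (v *v unit_rep p)
      \<le> norm (v *v unit_rep p - c *s (v *v unit_rep q))"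
    unfolding proj_act_def by (rule dist_proj_class_mult_norm_le[OF assms])
  also have "\<dots> = norm (v *v (unit_rep p - c *s unit_rep q))"
    by (simp add: matrix_vector_mult_diff_distrib vec.scale)
  also have "\<dots> \<le> opnorm_mat v * dist p q"
    using norm_mult_le_opnorm[of v "unit_rep p - c *s unit_rep q"] c by simp
  finally show ?thesis .
qed


lemma continuous_on_proj_class: "continuous_on (- {0}) (proj_class :: complex ^ 'k::finite \<Rightarrow> 'k proj)"
  unfolding continuous_on_def
proof
  fix a :: "complex ^ 'k" assume "a \<in> - {0}"
  then have a: "a \<noteq> 0" by simp
  have "\<forall>\<^sub>F b in at a within - {0}. dist (proj_class b) (proj_class a) \<le> norm (a - b) / norm a"
    unfolding eventually_at_filter
    using dist_proj_class_mult_norm_le[OF a, where c = 1] a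
    by (intro always_eventually) (simp add: field_simps dist_commute)
  moreover have "((\<lambda>b. norm (a - b) / norm a) \<longlongrightarrow> norm (a - a) / norm a) (at a within - {0})"
    using a by (intro tendsto_intros) auto
  ultimately show "(proj_class \<longlongrightarrow> proj_class a) (at a within - {0})"
    unfolding tendsto_dist_iff[of proj_class]
    by (intro tendsto_sandwich[where f = "\<lambda>_. 0" and g = "\<lambda>b. dist (proj_class b) (proj_class a)"
        and h = "\<lambda>b. norm (a - b) / norm a"]) auto
qed

section \<open>Hoelder functions\<close>

lemma holder_space_continuous:
  fixes f :: "'k::finite proj \<Rightarrow> complex"
  assumes "0 < \<alpha>" "f \<in> holder_space \<alpha>"
  shows "continuous_on UNIV f"
  unfolding continuous_on_def
proof
  fix p :: "'k proj"
  obtain C where C: "\<And>q r. norm (f q - f r) \<le> C * dist q r powr \<alpha>"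
    using assms(2) unfolding holder_space_def by blast
  have "((\<lambda>q. dist q p) \<longlongrightarrow> dist p p) (at p)"
    by (intro tendsto_intros)
  then have "((\<lambda>q. C * dist q p powr \<alpha>) \<longlongrightarrow> C * 0) (at p)"
    using assms(1) by (intro tendsto_mult tendsto_const tendsto_zero_powrI) auto
  then show "(f \<longlongrightarrow> f p) (at p within UNIV)"
    unfolding tendsto_dist_iff[of f]
    by (intro tendsto_sandwich[where f = "\<lambda>_. 0" and g = "\<lambda>q. dist (f q) (f p)"
        and h = "\<lambda>q. C * dist q p powr \<alpha>"]) (auto simp: C dist_norm)
qed

lemma holder_space_bounds:
  assumes "0 < \<alpha>" and f: "f \<in> holder_space \<alpha>"
  shows "norm (f p) \<le> (SUP p. norm (f p))"
    and "norm (f p - f q) \<le> holder_seminorm \<alpha> f * dist p q powr \<alpha>"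
    and "0 \<le> holder_seminorm \<alpha> f"
proof -
  obtain C where C: "\<And>q r. norm (f q - f r) \<le> C * dist q r powr \<alpha>"
    using assms(2) unfolding holder_space_def by blast
  have "norm (f q) \<le> norm (f p) + \<bar>C\<bar>" for q
  proof -
    have "norm (f q) \<le> norm (f p) + norm (f q - f p)"
      by (simp add: norm_triangle_sub)
    also have "norm (f q - f p) \<le> \<bar>C\<bar> * dist q p powr \<alpha>"
      by (rule order_trans[OF C]) (simp add: mult_right_mono)
    also have "\<dots> \<le> \<bar>C\<bar> * 1"
      using assms(1) dist_proj_le_1[of q p] by (intro mult_left_mono powr_le1) auto
    finally show ?thesis by simp
  qed
  then have "bdd_above (range (\<lambda>p. norm (f p)))" by (rule bdd_aboveI2)
  then show "norm (f p) \<le> (SUP p. norm (f p))" by (rule cSUP_upper[rotated]) simp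
  let ?Q = "insert 0 {norm (f p - f q) / dist p q powr \<alpha> | p q. p \<noteq> q}"
  have "bdd_above ?Q"
  proof (rule bdd_aboveI)
    fix t assume "t \<in> ?Q"
    then show "t \<le> \<bar>C\<bar>"
    proof
      assume "t \<in> {norm (f p - f q) / dist p q powr \<alpha> | p q. p \<noteq> q}"
      then obtain p q where t: "t = norm (f p - f q) / dist p q powr \<alpha>" "p \<noteq> q" by blast
      have "norm (f p - f q) \<le> \<bar>C\<bar> * dist p q powr \<alpha>"
        by (rule order_trans[OF C]) (simp add: mult_right_mono)
      then show ?thesis using t by (simp add: pos_divide_le_eq)
    qed simp
  qed
  note upper = cSup_upper[OF _ this, folded holder_seminorm_def]
  show "0 \<le> holder_seminorm \<alpha> f" by (rule upper) simp
  show "norm (f p - f q) \<le> holder_seminorm \<alpha> f * dist p q powr \<alpha>"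
  proof (cases "p = q")
    case False
    then have "norm (f p - f q) / dist p q powr \<alpha> \<le> holder_seminorm \<alpha> f"
      by (intro upper) blast
    then show ?thesis using False by (simp add: pos_divide_le_eq)
  qed simp
qed

lemma holder_norm_nonneg:
  assumes "0 < \<alpha>" "f \<in> holder_space \<alpha>"
  shows "0 \<le> holder_norm \<alpha> f"
  unfolding holder_norm_def
  using holder_space_bounds(1,3)[OF assms] norm_ge_zero[of "f undefined"]
  by (meson add_nonneg_nonneg order_trans)

lemma holder_norm_le:
  assumes sup: "\<And>p. norm (f p) \<le> S" and semi: "\<And>p q. norm (f p - f q) \<le> m * dist p q powr \<alpha>"
    and "0 \<le> m"
  shows "f \<in> holder_space \<alpha>" "holder_norm \<alpha> f \<le> S + m"
proof -
  show "f \<in> holder_space \<alpha>" unfolding holder_space_def using semi by blast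
  have "(SUP p. norm (f p)) \<le> S" by (rule cSUP_least) (simp_all add: sup)
  moreover have "holder_seminorm \<alpha> f \<le> m"
    unfolding holder_seminorm_def
    by (rule cSup_least) (use assms(3) semi in \<open>auto simp: pos_divide_le_eq\<close>)
  ultimately show "holder_norm \<alpha> f \<le> S + m" unfolding holder_norm_def by simp
qed

section \<open>Kernel operators\<close>

text \<open>The second condition says that \<open>W t / t powr \<alpha>\<close> is non-decreasing for \<open>t > 0\<close>: the weight vanishes at \<open>0\<close> at least as
  fast as \<open>t powr \<alpha>\<close>. This is what pays for the singularity \<open>1 / \<parallel>v x\<parallel>\<close> of the projective action,
  raised to the Hoelder exponent.\<close>

definition holder_weight :: "real \<Rightarrow> (real \<Rightarrow> real) \<Rightarrow> bool" where
  "holder_weight \<alpha> W \<longleftrightarrow> (\<forall>t\<ge>0. 0 \<le> W t) \<and>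
     (\<forall>s t. 0 < s \<and> s \<le> t \<longrightarrow> W s * t powr \<alpha> \<le> W t * s powr \<alpha>)"

text \<open>Kernels are functions of \<open>L = ln \<parallel>v x\<parallel>\<close>. In this variable \<open>\<parallel>v x\<parallel> powr w\<close> becomes \<open>exp (w L)\<close>, and a
  bound on \<open>g' L\<close> by \<open>W (exp L)\<close> is a bound on the derivative with respect to \<open>t = exp L\<close> by \<open>W t / t\<close>.
  The constant \<open>K\<close> plays the role of a norm of \<open>g\<close>: the operator norm is bounded by a multiple of it.\<close>

definition kernel_bound :: "(real \<Rightarrow> real) \<Rightarrow> real \<Rightarrow> (real \<Rightarrow> complex) \<Rightarrow> bool" where
  "kernel_bound W K g \<longleftrightarrow> 0 \<le> K \<and> (\<forall>L. norm (g L) \<le> K * W (exp L)) \<and>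
     (\<exists>g'. \<forall>L. (g has_vector_derivative g' L) (at L) \<and> norm (g' L) \<le> K * W (exp L))"

lemma kernel_boundI:
  assumes "0 \<le> K" "\<And>L. norm (g L) \<le> K * W (exp L)"
    and "\<And>L. (g has_vector_derivative g' L) (at L)" "\<And>L. norm (g' L) \<le> K * W (exp L)"
  shows "kernel_bound W K g"
  using assms unfolding kernel_bound_def by blast

definition kernel_integrand ::
    "(real \<Rightarrow> complex) \<Rightarrow> ('k::finite proj \<Rightarrow> complex) \<Rightarrow> 'k proj \<Rightarrow> complex ^ 'k ^ 'k \<Rightarrow> complex" where
  "kernel_integrand g f p v =
     (if v *v unit_rep p = 0 then 0
      else f (proj_act v p) * g (ln (norm (v *v unit_rep p))))"

definition kernel_op :: "(complex ^ 'k ^ 'k) measure \<Rightarrow> (real \<Rightarrow> complex) \<Rightarrow> 'k::finite fun_op" where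
  "kernel_op \<mu> g f p = (LINT v|\<mu>. kernel_integrand g f p v)"

text \<open>Subadditivity of \<open>t powr \<alpha>\<close>: after division by \<open>a powr \<alpha>\<close> it follows from \<open>u \<le> u powr \<alpha>\<close> on \<open>[0, 1]\<close>.\<close>

lemma powr_diff_le:
  assumes "0 \<le> b" "b \<le> a" "0 < \<alpha>" "\<alpha> \<le> (1::real)"
  shows "a powr \<alpha> - b powr \<alpha> \<le> (a - b) powr \<alpha>"
proof (cases "a = 0")
  case False
  then have a: "0 < a" using assms by simp
  have *: "t / a \<le> (t / a) powr \<alpha>" if "0 \<le> t" "t \<le> a" for t
    using powr_mono'[of \<alpha> 1 "t / a"] assms(4) a that by simp
  have "1 = (a - b) / a + b / a" using a by (simp add: field_simps)
  also have "\<dots> \<le> ((a - b) / a) powr \<alpha> + (b / a) powr \<alpha>"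
    using assms by (intro add_mono *) auto
  also have "\<dots> = ((a - b) powr \<alpha> + b powr \<alpha>) / a powr \<alpha>"
    using assms a by (simp add: powr_divide add_divide_distrib)
  finally show ?thesis using a by (simp add: pos_le_divide_eq)
qed (use assms in auto)

lemma holder_weightD:
  assumes "holder_weight \<alpha> W" "0 < s" "s \<le> t"
  shows "W s \<le> W t * (s / t) powr \<alpha>"
proof -
  have "W s * t powr \<alpha> \<le> W t * s powr \<alpha>" using assms unfolding holder_weight_def by blast
  then show ?thesis using assms by (simp add: powr_divide pos_le_divide_eq)
qed

lemma holder_weight_mono:
  assumes "holder_weight \<alpha> W" "0 \<le> \<alpha>" "0 < s" "s \<le> t"
  shows "W s \<le> W t"
proof -
  have "W s \<le> W t * (s / t) powr \<alpha>" by (rule holder_weightD[OF assms(1,3,4)])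
  also have "\<dots> \<le> W t * 1"
    using assms unfolding holder_weight_def by (intro mult_left_mono powr_le1) auto
  finally show ?thesis by simp
qed

text \<open>Up to the factor \<open>K * W M / M powr \<alpha>\<close>, the derivative of \<open>g\<close> is dominated by \<open>exp (\<alpha> L)\<close>, because
  \<open>W t / t powr \<alpha>\<close> is largest at \<open>t = M\<close> among all \<open>t \<le> M\<close>. Hence \<open>g (ln t)\<close> varies at most as \<open>t powr \<alpha> / \<alpha>\<close> does, and
  \<open>t powr \<alpha>\<close> is \<open>\<alpha>\<close>-Hoelder with constant 1.\<close>

lemma kernel_diff_le:
  assumes W: "holder_weight \<alpha> W" and g: "kernel_bound W K g"
    and \<alpha>: "0 < \<alpha>" "\<alpha> \<le> 1" and ba: "0 < b" "b \<le> a" "a \<le> M"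
  shows "norm (g (ln a) - g (ln b)) \<le> K * W M / \<alpha> * ((a - b) / M) powr \<alpha>"
proof (cases "a = b")
  case False
  then have lt: "ln b < ln a" using ba by simp
  have M: "0 < M" "0 < a" using ba by auto
  obtain g' where g': "\<And>L. (g has_vector_derivative g' L) (at L)"
      "\<And>L. norm (g' L) \<le> K * W (exp L)" and K: "0 \<le> K"
    using g unfolding kernel_bound_def by blast
  have WM: "0 \<le> W M" using W M unfolding holder_weight_def by simp
  define h where "h = (\<lambda>L. K * W M / \<alpha> * exp (\<alpha> * L) / M powr \<alpha>)"
  have h': "(h has_vector_derivative K * W M * exp (\<alpha> * L) / M powr \<alpha>) (at L)" for L
    unfolding h_def has_real_derivative_iff_has_vector_derivative[symmetric]
    using \<alpha> M by (auto intro!: derivative_eq_intros)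
  have "norm (g (ln a) - g (ln b)) \<le> h (ln a) - h (ln b)"
  proof (rule differentiable_bound_general[OF lt])
    show "continuous_on {ln b..ln a} g" "continuous_on {ln b..ln a} h"
      by (meson continuous_at_imp_continuous_on g'(1) h' has_vector_derivative_continuous)+
    fix L assume L: "ln b < L" "L < ln a"
    then have eL: "exp L \<le> M"
      using ba M by (metis exp_le_cancel_iff exp_ln less_eq_real_def order_trans)
    have "norm (g' L) \<le> K * W (exp L)" by (rule g')
    also have "\<dots> \<le> K * (W M * (exp L / M) powr \<alpha>)"
      using holder_weightD[OF W _ eL] K by (intro mult_left_mono) auto
    also have "\<dots> = K * W M * exp (\<alpha> * L) / M powr \<alpha>"
      using M by (simp add: powr_divide exp_powr_real mult.commute)
    finally show "norm (g' L) \<le> K * W M * exp (\<alpha> * L) / M powr \<alpha>" .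
  qed (use g' h' in auto)
  also have "\<dots> = K * W M / \<alpha> * ((a powr \<alpha> - b powr \<alpha>) / M powr \<alpha>)"
    using ba M by (simp add: h_def powr_def algebra_simps diff_divide_distrib)
  also have "\<dots> \<le> K * W M / \<alpha> * ((a - b) powr \<alpha> / M powr \<alpha>)"
    using powr_diff_le[of b a \<alpha>] ba \<alpha> K WM by (intro mult_left_mono divide_right_mono) auto
  also have "\<dots> = K * W M / \<alpha> * ((a - b) / M) powr \<alpha>"
    using ba M by (simp add: powr_divide)
  finally show ?thesis .
qed simp

lemma norm_kernel_integrand_le:
  assumes W: "holder_weight \<alpha> W" and g: "kernel_bound W K g" and \<alpha>: "0 < \<alpha>"
    and f: "\<And>p. norm (f p) \<le> S"
  shows "norm (kernel_integrand g f p v) \<le> K * W (opnorm_mat v) * S"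
proof -
  let ?a = "norm (v *v unit_rep p)"
  have K: "0 \<le> K" "\<And>L. norm (g L) \<le> K * W (exp L)"
    using g unfolding kernel_bound_def by auto
  have nn: "0 \<le> W (opnorm_mat v)" "0 \<le> S"
    using W opnorm_mat_nonneg order_trans[OF norm_ge_zero f] unfolding holder_weight_def by auto
  show ?thesis
  proof (cases "v *v unit_rep p = 0")
    case False
    have "norm (g (ln ?a)) \<le> K * W ?a" using K(2)[of "ln ?a"] False by simp
    also have "\<dots> \<le> K * W (opnorm_mat v)"
      using False K \<alpha> by (intro mult_left_mono holder_weight_mono[OF W] norm_mult_unit_rep_le) auto
    finally have "norm (f (proj_act v p)) * norm (g (ln ?a)) \<le> S * (K * W (opnorm_mat v))"
      using nn by (intro mult_mono f) auto
    then show ?thesis using False by (simp add: kernel_integrand_def norm_mult mult_ac)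
  qed (use K nn in \<open>simp add: kernel_integrand_def\<close>)
qed

text \<open>Write \<open>a \<ge> b\<close> for the norms of the images of the two representatives. The difference is split as
  \<open>(f (v\<cdot>p) - f (v\<cdot>q)) g (ln b) + f (v\<cdot>p) (g (ln a) - g (ln b))\<close>, with the kernel of the first term
  evaluated at the smaller norm \<open>b\<close>: there the Hoelder quotient of \<open>f\<close> costs
  \<open>(\<parallel>v\<parallel> / b) powr \<alpha>\<close>, at most what the weight gains between \<open>b\<close> and \<open>\<parallel>v\<parallel>\<close>. The
  second term is controlled by the regularity of the kernel (\<open>kernel_diff_le\<close>) because
  \<open>a - b \<le> \<parallel>v\<parallel> dist p q\<close>.\<close>

lemma kernel_integrand_holder:
  assumes W: "holder_weight \<alpha> W" and g: "kernel_bound W K g" and \<alpha>: "0 < \<alpha>" "\<alpha> \<le> 1"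
    and S: "\<And>p. norm (f p) \<le> S" and m: "\<And>p q. norm (f p - f q) \<le> m * dist p q powr \<alpha>" "0 \<le> m"
  shows "norm (kernel_integrand g f p v - kernel_integrand g f q v)
           \<le> K * W (opnorm_mat v) * ((m + S / \<alpha>) * dist p q powr \<alpha>)"
proof -
  have K: "0 \<le> K" "\<And>L. norm (g L) \<le> K * W (exp L)"
    using g unfolding kernel_bound_def by auto
  define M where "M = opnorm_mat v"
  have nn: "0 \<le> W M" "0 \<le> S"
    using W opnorm_mat_nonneg[of v] order_trans[OF norm_ge_zero S]
    unfolding holder_weight_def M_def by auto
  have main: "norm (kernel_integrand g f p v - kernel_integrand g f q v)
           \<le> K * W M * ((m + S / \<alpha>) * dist p q powr \<alpha>)"
    if le: "norm (v *v unit_rep q) \<le> norm (v *v unit_rep p)" for p q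
  proof -
    define a where "a = norm (v *v unit_rep p)"
    define b where "b = norm (v *v unit_rep q)"
    have ab: "0 \<le> b" "b \<le> a" "a \<le> M" "a \<le> b + M * dist p q"
      using le norm_mult_unit_rep_le[of v p] norm_mult_unit_rep_diff[of v p q]
      by (auto simp: a_def b_def M_def)
    consider "a = 0" | "b = 0" "0 < a" | "0 < b" using ab by linarith
    then show ?thesis
    proof cases
      case 1
      then have "v *v unit_rep p = 0" "v *v unit_rep q = 0" using ab by (auto simp: a_def b_def)
      then show ?thesis using K nn m \<alpha> by (simp add: kernel_integrand_def)
    next
      \<comment> \<open>One image vanishes: then \<open>a\<close> itself is at most \<open>M * dist p q\<close>, and the decay of the weight
        at \<open>0\<close> suffices.\<close>
      case 2
      then have M: "0 < M" using ab by simp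
      have "norm (g (ln a)) \<le> K * W a" using K(2)[of "ln a"] 2 by simp
      also have "\<dots> \<le> K * (W M * (a / M) powr \<alpha>)"
        using holder_weightD[OF W 2(2) ab(3)] K by (intro mult_left_mono)
      also have "\<dots> \<le> K * (W M * dist p q powr \<alpha>)"
        using ab 2 M K nn \<alpha>
        by (intro mult_left_mono powr_mono2) (auto simp: pos_divide_le_eq mult.commute)
      finally have "norm (f (proj_act v p)) * norm (g (ln a)) \<le> S * (K * (W M * dist p q powr \<alpha>))"
        using nn by (intro mult_mono S) auto
      also have "\<dots> = K * W M * (S * dist p q powr \<alpha>)" by simp
      also have "\<dots> \<le> K * W M * ((m + S / \<alpha>) * dist p q powr \<alpha>)"
      proof -
        have "S * \<alpha> \<le> S * 1" using nn \<alpha> by (intro mult_left_mono) auto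
        then have "S \<le> S / \<alpha>" using \<alpha> by (simp add: pos_le_divide_eq)
        then show ?thesis using m K nn by (intro mult_left_mono mult_right_mono) auto
      qed
      finally show ?thesis
        using 2 by (auto simp: kernel_integrand_def norm_mult a_def b_def)
    next
      case 3
      then have nz: "v *v unit_rep p \<noteq> 0" "v *v unit_rep q \<noteq> 0"
        using ab by (auto simp: a_def b_def)
      have M: "0 < M" "0 < a" using ab 3 by auto
      let ?d = "dist p q"
      have "dist (proj_act v q) (proj_act v p) \<le> M * ?d / b"
        using dist_proj_act[OF nz(2,1)] 3 by (simp add: M_def b_def pos_le_divide_eq dist_commute)
      then have "norm (f (proj_act v p) - f (proj_act v q)) \<le> m * (M * ?d / b) powr \<alpha>"
        using \<alpha> m(2)
        by (intro order_trans[OF m(1)] mult_left_mono powr_mono2) (auto simp: dist_commute)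
      moreover have "norm (g (ln b)) \<le> K * (W M * (b / M) powr \<alpha>)"
        using K(2)[of "ln b"] holder_weightD[OF W 3, of M] ab 3 K(1)
        by (smt (verit, best) exp_ln mult_left_mono)
      ultimately have "norm ((f (proj_act v p) - f (proj_act v q)) * g (ln b))
          \<le> m * (M * ?d / b) powr \<alpha> * (K * (W M * (b / M) powr \<alpha>))"
        unfolding norm_mult using m(2) by (intro mult_mono) auto
      also have "\<dots> = K * W M * (m * ?d powr \<alpha>)"
        using M 3 by (simp add: powr_divide powr_mult)
      finally have 1: "norm ((f (proj_act v p) - f (proj_act v q)) * g (ln b))
          \<le> K * W M * (m * ?d powr \<alpha>)" .
      have "norm (g (ln a) - g (ln b)) \<le> K * W M / \<alpha> * ((a - b) / M) powr \<alpha>"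
        by (rule kernel_diff_le[OF W g \<alpha> 3 ab(2,3)])
      also have "\<dots> \<le> K * W M / \<alpha> * ?d powr \<alpha>"
        using ab M K nn \<alpha>
        by (intro mult_left_mono powr_mono2) (auto simp: pos_divide_le_eq mult.commute)
      finally have "norm (f (proj_act v p) * (g (ln a) - g (ln b))) \<le> S * (K * W M / \<alpha> * ?d powr \<alpha>)"
        unfolding norm_mult using nn by (intro mult_mono S) auto
      moreover have "kernel_integrand g f p v - kernel_integrand g f q v
          = (f (proj_act v p) - f (proj_act v q)) * g (ln b) + f (proj_act v p) * (g (ln a) - g (ln b))"
        using nz by (simp add: kernel_integrand_def a_def b_def algebra_simps)
      ultimately have "norm (kernel_integrand g f p v - kernel_integrand g f q v)
          \<le> K * W M * (m * ?d powr \<alpha>) + S * (K * W M / \<alpha> * ?d powr \<alpha>)"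
        using 1 norm_triangle_mono by metis
      then show ?thesis by (simp add: algebra_simps)
    qed
  qed
  show ?thesis
    using main[of q p] main[of p q] unfolding M_def
    by (cases "norm (v *v unit_rep q) \<le> norm (v *v unit_rep p)")
      (auto simp: dist_commute norm_minus_commute)
qed

lemma kernel_bound_continuous:
  assumes "kernel_bound W K g"
  shows "continuous_on UNIV g"
  using assms unfolding kernel_bound_def
  by (metis continuous_at_imp_continuous_on has_vector_derivative_continuous)

text \<open>The integrand is continuous on the open set of matrices that do not annihilate the representative
  of \<open>p\<close>, and zero on the complement.\<close>

lemma kernel_integrand_measurable:
  fixes f :: "'k::finite proj \<Rightarrow> complex"
  assumes "0 < \<alpha>" and f: "f \<in> holder_space \<alpha>" and g: "kernel_bound W K g"
  shows "kernel_integrand g f p \<in> borel_measurable borel"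
proof -
  let ?A = "{v :: complex ^ 'k ^ 'k. v *v unit_rep p \<noteq> 0}"
  have cont: "continuous_on A (\<lambda>v :: complex ^ 'k ^ 'k. v *v unit_rep p)" for A
    unfolding matrix_vector_mult_def by (intro continuous_intros)
  have "open ?A"
    using open_Collect_neq[OF cont[of UNIV] continuous_on_const[of UNIV 0]] by simp
  moreover have "continuous_on ?A (\<lambda>v. f (proj_act v p) * g (ln (norm (v *v unit_rep p))))"
  proof (intro continuous_on_mult)
    show "continuous_on ?A (\<lambda>v. f (proj_act v p))"
      unfolding proj_act_def
      by (intro continuous_on_compose2[OF holder_space_continuous[OF assms(1) f]]
          continuous_on_compose2[OF continuous_on_proj_class] cont) auto
    show "continuous_on ?A (\<lambda>v. g (ln (norm (v *v unit_rep p))))"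
      by (intro continuous_on_compose2[OF kernel_bound_continuous[OF g]]
          continuous_on_ln continuous_on_norm cont) auto
  qed
  ultimately have "(\<lambda>v. if v \<in> ?A then f (proj_act v p) * g (ln (norm (v *v unit_rep p))) else 0)
      \<in> borel_measurable borel"
    by (intro borel_measurable_continuous_on_if continuous_on_const) auto
  also have "(\<lambda>v. if v \<in> ?A then f (proj_act v p) * g (ln (norm (v *v unit_rep p))) else 0)
      = kernel_integrand g f p"
    by (auto simp: kernel_integrand_def)
  finally show ?thesis .
qed

text \<open>The setting in which a pointwise estimate by \<open>W (opnorm_mat v)\<close> integrates to an estimate of
  operators on the Hoelder space.\<close>

locale weighted_measure =
  fixes \<mu> :: "(complex ^ 'k::finite ^ 'k) measure" and \<alpha> :: real and W :: "real \<Rightarrow> real"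
  assumes borel: "sets \<mu> = sets borel"
    and \<alpha>: "0 < \<alpha>" "\<alpha> \<le> 1"
    and W: "holder_weight \<alpha> W"
    and int: "integrable \<mu> (\<lambda>v. W (opnorm_mat v))"
begin

lemma kernel_integrand_integrable:
  assumes "f \<in> holder_space \<alpha>" "kernel_bound W K g"
  shows "integrable \<mu> (kernel_integrand g f p)"
proof (rule Bochner_Integration.integrable_bound)
  let ?S = "SUP p. norm (f p)"
  show "integrable \<mu> (\<lambda>v. K * W (opnorm_mat v) * ?S)"
    using int by simp
  show "kernel_integrand g f p \<in> borel_measurable \<mu>"
    using kernel_integrand_measurable[OF \<alpha>(1) assms] measurable_cong_sets[OF borel refl] by blast
  show "AE v in \<mu>. norm (kernel_integrand g f p v) \<le> norm (K * W (opnorm_mat v) * ?S)"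
    unfolding real_norm_def
    by (intro always_eventually allI order_trans[OF _ abs_ge_self]
        norm_kernel_integrand_le[OF W assms(2) \<alpha>(1)] holder_space_bounds(1)[OF \<alpha>(1) assms(1)])
qed

definition weight_integral :: real where
  "weight_integral = (LINT v|\<mu>. W (opnorm_mat v))"

lemma weight_integral_nonneg: "0 \<le> weight_integral"
  unfolding weight_integral_def
  using W opnorm_mat_nonneg unfolding holder_weight_def by (intro integral_nonneg_AE) auto

text \<open>With \<open>S\<close> the supremum norm and \<open>m\<close> the Hoelder seminorm of \<open>f\<close>, the image has supremum norm at
  most a multiple of \<open>S\<close> and, integrating \<open>kernel_integrand_holder\<close>, seminorm at most the same
  multiple of \<open>m + S / \<alpha>\<close>.\<close>

lemma kernel_op_bounds:
  assumes f: "f \<in> holder_space \<alpha>" and g: "kernel_bound W K g"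
  shows "kernel_op \<mu> g f \<in> holder_space \<alpha>"
    and "holder_norm \<alpha> (kernel_op \<mu> g f) \<le> K * weight_integral * (1 + 1 / \<alpha>) * holder_norm \<alpha> f"
proof -
  define S where "S = (SUP p. norm (f p))"
  define m where "m = holder_seminorm \<alpha> f"
  note fb = holder_space_bounds[OF \<alpha>(1) f, folded S_def m_def]
  note integrable = kernel_integrand_integrable[OF f g]
  have K: "0 \<le> K" using g unfolding kernel_bound_def by simp
  have S: "0 \<le> S" using order_trans[OF norm_ge_zero fb(1)] .
  note I = weight_integral_nonneg
  have sup: "norm (kernel_op \<mu> g f p) \<le> K * weight_integral * S" for p
  proof -
    have "norm (kernel_op \<mu> g f p) \<le> (LINT v|\<mu>. K * W (opnorm_mat v) * S)"
      unfolding kernel_op_def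
      using int norm_kernel_integrand_le[OF W g \<alpha>(1) fb(1)]
      by (intro Bochner_Integration.integral_norm_bound_integral integrable) auto
    then show ?thesis by (simp add: weight_integral_def)
  qed
  have semi: "norm (kernel_op \<mu> g f p - kernel_op \<mu> g f q)
      \<le> K * weight_integral * (m + S / \<alpha>) * dist p q powr \<alpha>" for p q
  proof -
    have "norm (kernel_op \<mu> g f p - kernel_op \<mu> g f q)
        = norm (LINT v|\<mu>. kernel_integrand g f p v - kernel_integrand g f q v)"
      unfolding kernel_op_def using integrable by simp
    also have "\<dots> \<le> (LINT v|\<mu>. K * W (opnorm_mat v) * ((m + S / \<alpha>) * dist p q powr \<alpha>))"
      using int kernel_integrand_holder[OF W g \<alpha> fb]
      by (intro Bochner_Integration.integral_norm_bound_integral Bochner_Integration.integrable_diff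
          integrable) auto
    finally show ?thesis by (simp add: weight_integral_def mult_ac)
  qed
  have nn: "0 \<le> K * weight_integral * (m + S / \<alpha>)"
    using K I fb(3) S \<alpha> by simp
  show "kernel_op \<mu> g f \<in> holder_space \<alpha>"
    using holder_norm_le(1)[OF sup semi nn] .
  have "holder_norm \<alpha> (kernel_op \<mu> g f)
      \<le> K * weight_integral * S + K * weight_integral * (m + S / \<alpha>)"
    using holder_norm_le(2)[OF sup semi nn] .
  also have "\<dots> = K * weight_integral * (m + (1 + 1 / \<alpha>) * S)"
    by (simp add: algebra_simps)
  also have "\<dots> \<le> K * weight_integral * ((1 + 1 / \<alpha>) * m + (1 + 1 / \<alpha>) * S)"
    using K I fb(3) \<alpha> by (intro mult_left_mono add_right_mono) (auto simp: algebra_simps)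
  finally show "holder_norm \<alpha> (kernel_op \<mu> g f)
      \<le> K * weight_integral * (1 + 1 / \<alpha>) * holder_norm \<alpha> f"
    unfolding holder_norm_def S_def[symmetric] m_def[symmetric]
    by (simp add: algebra_simps add_divide_distrib)
qed

lemma bounded_endo_kernel_op:
  assumes g: "kernel_bound W K g"
  shows "bounded_endo \<alpha> (kernel_op \<mu> g)"
  unfolding bounded_endo_def
proof (intro conjI ballI allI exI)
  fix f h :: "'k proj \<Rightarrow> complex" and c
  assume f: "f \<in> holder_space \<alpha>"
  show "kernel_op \<mu> g f \<in> holder_space \<alpha>"
    "holder_norm \<alpha> (kernel_op \<mu> g f) \<le> K * weight_integral * (1 + 1 / \<alpha>) * holder_norm \<alpha> f"
    by (rule kernel_op_bounds[OF f g])+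
  have "kernel_integrand g (\<lambda>p. c * f p) p = (\<lambda>v. c * kernel_integrand g f p v)" for p
    by (auto simp: kernel_integrand_def fun_eq_iff)
  then show "kernel_op \<mu> g (\<lambda>p. c * f p) = (\<lambda>p. c * kernel_op \<mu> g f p)"
    by (simp add: kernel_op_def fun_eq_iff)
  assume h: "h \<in> holder_space \<alpha>"
  have "kernel_integrand g (\<lambda>p. f p + h p) p = (\<lambda>v. kernel_integrand g f p v + kernel_integrand g h p v)" for p
    by (auto simp: kernel_integrand_def fun_eq_iff algebra_simps)
  then show "kernel_op \<mu> g (\<lambda>p. f p + h p) = (\<lambda>p. kernel_op \<mu> g f p + kernel_op \<mu> g h p)"
    using kernel_integrand_integrable[OF f g] kernel_integrand_integrable[OF h g]
    by (simp add: kernel_op_def fun_eq_iff)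
qed

text \<open>The operator \<open>T\<close> is required to agree with a kernel operator only on the Hoelder space, which is all that
  \<^const>\<open>endo_norm\<close> sees. For a linear combination of kernel operators this is what linearity of the
  integral gives, since it needs all the integrals involved to exist.\<close>

lemma endo_norm_kernel_op_le:
  assumes T: "\<And>f. f \<in> holder_space \<alpha> \<Longrightarrow> T f = kernel_op \<mu> g f" and g: "kernel_bound W K g"
  shows "0 \<le> endo_norm \<alpha> T" "endo_norm \<alpha> T \<le> K * weight_integral * (1 + 1 / \<alpha>)"
proof -
  let ?B = "K * weight_integral * (1 + 1 / \<alpha>)"
  have K: "0 \<le> K" using g unfolding kernel_bound_def by simp
  note I = weight_integral_nonneg
  have le: "holder_norm \<alpha> (T f) / holder_norm \<alpha> f \<le> ?B" if f: "f \<in> holder_space \<alpha>" for f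
  proof (cases "holder_norm \<alpha> f = 0")
    case False
    then have "0 < holder_norm \<alpha> f" using holder_norm_nonneg[OF \<alpha>(1) f] by simp
    then show ?thesis
      using kernel_op_bounds(2)[OF f g] by (simp add: T[OF f] pos_divide_le_eq)
  qed (use K I \<alpha> in simp)
  have zero: "(\<lambda>_. 0) \<in> (holder_space \<alpha> :: ('k proj \<Rightarrow> complex) set)"
    unfolding holder_space_def by (auto intro: exI[of _ 0])
  have "0 \<le> holder_norm \<alpha> (T (\<lambda>_. 0)) / holder_norm \<alpha> (\<lambda>_ :: 'k proj. 0)"
    using kernel_op_bounds(1)[OF zero g] zero
    by (auto intro!: divide_nonneg_nonneg holder_norm_nonneg \<alpha> simp: T)
  also have "\<dots> \<le> endo_norm \<alpha> T"
    unfolding endo_norm_def using le zero by (intro cSUP_upper bdd_aboveI2[where M = ?B]) auto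
  finally show "0 \<le> endo_norm \<alpha> T" .
  show "endo_norm \<alpha> T \<le> ?B"
    unfolding endo_norm_def using le zero by (intro cSUP_least) auto
qed

end

section \<open>Exponential kernels\<close>

text \<open>Each term of the tail has index at least \<open>N\<close>, so a factor \<open>q ^ N\<close> can be extracted from it; what is left
  is dominated by the exponential series at \<open>s\<close>. With \<open>w = \<zeta> L\<close>, \<open>s = r \<bar>L\<bar>\<close> and
  \<open>q = \<bar>\<zeta>\<bar> / r\<close> the decay in \<open>N\<close> is uniform in \<open>L\<close>, at the price of \<open>exp (r \<bar>L\<bar>)\<close>.\<close>

lemma norm_exp_remainder_le:
  fixes w :: complex
  assumes w: "norm w \<le> q * s" and q: "0 \<le> q" "q \<le> 1" and s: "0 \<le> s"
  shows "norm (exp w - (\<Sum>n<N. w ^ n / fact n)) \<le> q ^ N * exp s"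
proof -
  have sw: "(\<lambda>n. w ^ n / fact n) sums exp w" and ss: "(\<lambda>n. s ^ n / fact n) sums exp s"
    using exp_converges[of w] exp_converges[of s] by (simp_all add: scaleR_conv_of_real field_simps)
  have tw: "(\<lambda>n. w ^ (n + N) / fact (n + N)) sums (exp w - (\<Sum>n<N. w ^ n / fact n))"
    by (rule sums_split_initial_segment[OF sw])
  have ts: "(\<lambda>n. s ^ (n + N) / fact (n + N)) sums (exp s - (\<Sum>n<N. s ^ n / fact n))"
    by (rule sums_split_initial_segment[OF ss])
  have coeff: "norm (w ^ (n + N) / fact (n + N)) \<le> q ^ N * (s ^ (n + N) / fact (n + N))" for n
  proof -
    have "norm w ^ (n + N) \<le> (q * s) ^ (n + N)" by (rule power_mono[OF w]) simp
    also have "\<dots> = q ^ N * s ^ (n + N) * q ^ n" by (simp add: power_mult_distrib power_add)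
    also have "\<dots> \<le> q ^ N * s ^ (n + N) * 1"
      using q s by (intro mult_left_mono power_le_one) auto
    finally show ?thesis by (simp add: norm_divide norm_power divide_right_mono)
  qed
  have "norm (exp w - (\<Sum>n<N. w ^ n / fact n)) \<le> q ^ N * (exp s - (\<Sum>n<N. s ^ n / fact n))"
    unfolding sums_unique[OF tw] sums_unique[OF sums_mult[OF ts]]
    by (rule norm_suminf_le[OF coeff sums_summable[OF sums_mult[OF ts]]])
  also have "\<dots> \<le> q ^ N * exp s"
    using q s by (intro mult_left_mono) (auto intro: sum_nonneg)
  finally show ?thesis .
qed

definition power_weight :: "real \<Rightarrow> real \<Rightarrow> real \<Rightarrow> real" where
  "power_weight \<beta> \<gamma> t = t powr \<beta> + t powr \<gamma>"

text \<open>\<open>t powr (\<beta> - \<alpha>)\<close> is non-decreasing. For the moments of the theorem the smaller exponent is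
  \<open>2 - \<tau> = 2 * \<alpha>\<close>.\<close>

lemma holder_weight_power_weight:
  assumes "\<alpha> \<le> \<beta>" "\<alpha> \<le> \<gamma>"
  shows "holder_weight \<alpha> (power_weight \<beta> \<gamma>)"
proof -
  have *: "s powr \<beta> * t powr \<alpha> \<le> t powr \<beta> * s powr \<alpha>" if "0 < s" "s \<le> t" "\<alpha> \<le> \<beta>" for s t \<beta>
  proof -
    have "s powr \<beta> * t powr \<alpha> = s powr (\<beta> - \<alpha>) * (s powr \<alpha> * t powr \<alpha>)"
      using that by (simp flip: powr_add mult.assoc)
    also have "\<dots> \<le> t powr (\<beta> - \<alpha>) * (s powr \<alpha> * t powr \<alpha>)"
      using that by (intro mult_right_mono powr_mono2) auto
    also have "\<dots> = t powr \<beta> * s powr \<alpha>"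
      using that by (simp add: powr_diff)
    finally show ?thesis .
  qed
  show ?thesis
    unfolding holder_weight_def power_weight_def
    using *[of _ _ \<beta>] *[of _ _ \<gamma>] assms by (auto simp: distrib_right intro!: add_mono)
qed

text \<open>The loss \<open>exp (r \<bar>L\<bar>)\<close> amounts to shifting the exponent \<open>\<sigma>\<close> by \<open>r\<close> to the right for \<open>L \<ge> 0\<close> and to the
  left for \<open>L < 0\<close>; both shifted exponents stay between \<open>\<beta>\<close> and \<open>\<gamma>\<close>.\<close>

lemma exp_times_exp_abs_le_power_weight:
  assumes "\<beta> \<le> \<sigma> - r" "\<sigma> + r \<le> \<gamma>"
  shows "exp (\<sigma> * L) * exp (r * \<bar>L\<bar>) \<le> power_weight \<beta> \<gamma> (exp L)"
proof (cases "0 \<le> L")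
  case True
  then have "(\<sigma> + r) * L \<le> \<gamma> * L" using assms by (intro mult_right_mono)
  then have "exp (\<sigma> * L) * exp (r * \<bar>L\<bar>) \<le> exp (\<gamma> * L)"
    using True by (simp add: algebra_simps flip: exp_add)
  then show ?thesis by (simp add: power_weight_def exp_powr_real mult.commute add_increasing)
next
  case False
  then have "(\<sigma> - r) * L \<le> \<beta> * L" using assms by (intro mult_right_mono_neg) auto
  then have "exp (\<sigma> * L) * exp (r * \<bar>L\<bar>) \<le> exp (\<beta> * L)"
    using False by (simp add: algebra_simps flip: exp_add)
  then show ?thesis by (simp add: power_weight_def exp_powr_real mult.commute add_increasing2)
qed

text \<open>The coefficient of \<open>\<zeta> ^ n\<close> in the expansion of \<open>exp ((w + \<zeta>) L)\<close>; the kernel of \<open>\<Gamma>\<^sub>z\<close>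
  is the one with \<open>w = 2 + z\<close> and \<open>n = 0\<close>.\<close>

definition exp_coeff :: "complex \<Rightarrow> nat \<Rightarrow> real \<Rightarrow> complex" where
  "exp_coeff w n L = exp (w * of_real L) * (of_real L ^ n / fact n)"

definition exp_remainder :: "complex \<Rightarrow> complex \<Rightarrow> nat \<Rightarrow> real \<Rightarrow> complex" where
  "exp_remainder w \<zeta> N L = exp ((w + \<zeta>) * of_real L) - (\<Sum>n<N. \<zeta> ^ n * exp_coeff w n L)"

lemma exp_coeff_has_derivative:
  "(exp_coeff w n has_vector_derivative
     w * exp_coeff w n L + (case n of 0 \<Rightarrow> 0 | Suc k \<Rightarrow> exp_coeff w k L)) (at L)"
proof -
  have power: "((\<lambda>z. z ^ n / fact n) has_field_derivative
      (case n of 0 \<Rightarrow> 0 | Suc k \<Rightarrow> z ^ k / fact k)) (at z)" for z :: complex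
  proof (cases n)
    case (Suc k)
    have "((\<lambda>z. z ^ Suc k / fact (Suc k)) has_field_derivative
        (of_nat (Suc k) * z ^ k / fact (Suc k))) (at z)"
      by (auto intro!: derivative_eq_intros simp del: of_nat_Suc power_Suc fact_Suc)
    also have "of_nat (Suc k) * z ^ k / fact (Suc k) = z ^ k / fact k"
      unfolding fact_Suc by (simp del: of_nat_Suc)
    finally show ?thesis using Suc by simp
  qed simp
  have "((\<lambda>z. exp (w * z) * (z ^ n / fact n)) has_field_derivative
      w * (exp (w * z) * (z ^ n / fact n))
        + (case n of 0 \<Rightarrow> 0 | Suc k \<Rightarrow> exp (w * z) * (z ^ k / fact k))) (at z)" for z
  proof -
    have "((\<lambda>z. exp (w * z)) has_field_derivative w * exp (w * z)) (at z)"
      by (auto intro!: derivative_eq_intros)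
    from DERIV_mult[OF this power] show ?thesis
      by (rule DERIV_cong) (simp add: mult_ac split: nat.split)
  qed
  from has_vector_derivative_real_field[OF this] show ?thesis
    unfolding exp_coeff_def .
qed

text \<open>The term \<open>(r \<bar>L\<bar>) ^ n / n!\<close> is at most \<open>exp (r \<bar>L\<bar>)\<close>. The derivative is \<open>w\<close> times the kernel plus
  the kernel with index \<open>n - 1\<close>, whence the summands \<open>norm w\<close> and \<open>r\<close> of the constant.\<close>

lemma kernel_bound_exp_coeff:
  assumes r: "0 < r" and w: "\<beta> \<le> Re w - r" "Re w + r \<le> \<gamma>"
  shows "kernel_bound (power_weight \<beta> \<gamma>) ((1 / r) ^ n * (norm w + r + 1)) (exp_coeff w n)"
proof -
  define V where "V = power_weight \<beta> \<gamma>"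
  have V: "0 \<le> V t" for t by (simp add: V_def power_weight_def)
  have le: "norm (exp_coeff w n L) \<le> (1 / r) ^ n * V (exp L)" for n L
  proof -
    have "(\<lambda>n. (r * \<bar>L\<bar>) ^ n / fact n) sums exp (r * \<bar>L\<bar>)"
      using exp_converges[of "r * \<bar>L\<bar>"] by (simp add: field_simps)
    then have "(\<Sum>k\<in>{n}. (r * \<bar>L\<bar>) ^ k / fact k) \<le> exp (r * \<bar>L\<bar>)"
      using r sum_le_suminf[of "\<lambda>n. (r * \<bar>L\<bar>) ^ n / fact n" "{n}"]
      by (simp add: sums_iff)
    then have "exp (Re w * L) * ((r * \<bar>L\<bar>) ^ n / fact n) \<le> exp (Re w * L) * exp (r * \<bar>L\<bar>)"
      by (intro mult_left_mono) auto
    also have "\<dots> \<le> V (exp L)"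
      unfolding V_def by (rule exp_times_exp_abs_le_power_weight[OF w])
    finally have "(1 / r) ^ n * (exp (Re w * L) * ((r * \<bar>L\<bar>) ^ n / fact n)) \<le> (1 / r) ^ n * V (exp L)"
      using r by (intro mult_left_mono) auto
    moreover have "norm (exp_coeff w n L) = (1 / r) ^ n * (exp (Re w * L) * ((r * \<bar>L\<bar>) ^ n / fact n))"
      using r by (simp add: exp_coeff_def norm_mult norm_divide norm_power power_mult_distrib power_divide)
    ultimately show ?thesis by simp
  qed
  have d: "norm (w * exp_coeff w n L + (case n of 0 \<Rightarrow> 0 | Suc k \<Rightarrow> exp_coeff w k L))
      \<le> (1 / r) ^ n * (norm w + r) * V (exp L)" for L
  proof -
    have "norm (case n of 0 \<Rightarrow> 0 | Suc k \<Rightarrow> exp_coeff w k L) \<le> (1 / r) ^ n * r * V (exp L)"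
      using le[of _ L] r V by (cases n) auto
    moreover have "norm (w * exp_coeff w n L) \<le> norm w * ((1 / r) ^ n * V (exp L))"
      unfolding norm_mult by (intro mult_left_mono le) auto
    ultimately show ?thesis
      by (intro norm_triangle_le) (simp add: algebra_simps)
  qed
  have "norm (exp_coeff w n L) \<le> (1 / r) ^ n * (norm w + r + 1) * V (exp L)" for L
  proof (rule order_trans[OF le mult_right_mono[OF _ V]])
    show "(1 / r) ^ n \<le> (1 / r) ^ n * (norm w + r + 1)"
      using r by (simp add: mult_le_cancel_left1)
  qed
  moreover have "norm (w * exp_coeff w n L + (case n of 0 \<Rightarrow> 0 | Suc k \<Rightarrow> exp_coeff w k L))
      \<le> (1 / r) ^ n * (norm w + r + 1) * V (exp L)" for L
    using r V by (intro order_trans[OF d] mult_right_mono mult_left_mono) auto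
  ultimately show ?thesis
    unfolding V_def[symmetric]
    using r by (intro kernel_boundI[OF _ _ exp_coeff_has_derivative]) auto
qed

text \<open>The same scheme as for the coefficients: the derivative of the remainder of order \<open>N + 1\<close> is
  \<open>w\<close> times itself plus \<open>\<zeta>\<close> times the remainder of order \<open>N\<close>. The factor \<open>\<zeta> = q r\<close> (in modulus)
  restores the missing power of \<open>q\<close>, so that both parts decay like \<open>q ^ (N + 1)\<close>.\<close>

lemma kernel_bound_exp_remainder:
  assumes r: "0 < r" and w: "\<beta> \<le> Re w - r" "Re w + r \<le> \<gamma>" and \<zeta>: "norm \<zeta> \<le> r"
  shows "kernel_bound (power_weight \<beta> \<gamma>) ((norm \<zeta> / r) ^ Suc N * (norm w + r + 1))
           (exp_remainder w \<zeta> (Suc N))"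
proof -
  define V where "V = power_weight \<beta> \<gamma>"
  define q where "q = norm \<zeta> / r"
  have q: "0 \<le> q" "q \<le> 1" "norm \<zeta> = q * r" using r \<zeta> by (auto simp: q_def)
  have V: "0 \<le> V t" for t by (simp add: V_def power_weight_def)
  have le: "norm (exp_remainder w \<zeta> N L) \<le> q ^ N * V (exp L)" for N L
  proof -
    have "exp_remainder w \<zeta> N L
        = exp (w * of_real L) * (exp (\<zeta> * of_real L) - (\<Sum>n<N. (\<zeta> * of_real L) ^ n / fact n))"
      unfolding exp_remainder_def exp_coeff_def right_diff_distrib sum_distrib_left
        distrib_right exp_add
      by (simp add: power_mult_distrib mult_ac)
    then have "norm (exp_remainder w \<zeta> N L)
        = exp (Re w * L) * norm (exp (\<zeta> * of_real L) - (\<Sum>n<N. (\<zeta> * of_real L) ^ n / fact n))"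
      by (simp add: norm_mult)
    also have "\<dots> \<le> exp (Re w * L) * (q ^ N * exp (r * \<bar>L\<bar>))"
      using q r by (intro mult_left_mono norm_exp_remainder_le) (auto simp: norm_mult)
    also have "\<dots> = q ^ N * (exp (Re w * L) * exp (r * \<bar>L\<bar>))" by simp
    also have "\<dots> \<le> q ^ N * V (exp L)"
      unfolding V_def using q
      by (intro mult_left_mono exp_times_exp_abs_le_power_weight[OF w]) auto
    finally show ?thesis .
  qed
  have deriv: "(exp_remainder w \<zeta> (Suc N) has_vector_derivative
      w * exp_remainder w \<zeta> (Suc N) L + \<zeta> * exp_remainder w \<zeta> N L) (at L)" for L
  proof -
    have 1: "((\<lambda>L. exp ((w + \<zeta>) * of_real L)) has_vector_derivative
        (w + \<zeta>) * exp ((w + \<zeta>) * of_real L)) (at L)"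
      by (rule has_vector_derivative_real_field) (auto intro!: derivative_eq_intros)
    have 2: "((\<lambda>L. \<zeta> ^ n * exp_coeff w n L) has_vector_derivative
        \<zeta> ^ n * (w * exp_coeff w n L + (case n of 0 \<Rightarrow> 0 | Suc k \<Rightarrow> exp_coeff w k L))) (at L)" for n
      by (rule has_vector_derivative_mult_right[OF exp_coeff_has_derivative])
    have "(exp_remainder w \<zeta> (Suc N) has_vector_derivative
        (w + \<zeta>) * exp ((w + \<zeta>) * of_real L) - (\<Sum>n<Suc N.
          \<zeta> ^ n * (w * exp_coeff w n L + (case n of 0 \<Rightarrow> 0 | Suc k \<Rightarrow> exp_coeff w k L)))) (at L)"
      unfolding exp_remainder_def[abs_def]
      by (intro has_vector_derivative_diff 1 has_vector_derivative_sum 2)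
    also have "(\<Sum>n<Suc N. \<zeta> ^ n * (w * exp_coeff w n L + (case n of 0 \<Rightarrow> 0 | Suc k \<Rightarrow> exp_coeff w k L)))
        = (\<Sum>n<Suc N. w * (\<zeta> ^ n * exp_coeff w n L))
          + (\<Sum>n<Suc N. \<zeta> ^ n * (case n of 0 \<Rightarrow> 0 | Suc k \<Rightarrow> exp_coeff w k L))"
      unfolding sum.distrib[symmetric] by (intro sum.cong) (auto simp: algebra_simps)
    also have "(\<Sum>n<Suc N. \<zeta> ^ n * (case n of 0 \<Rightarrow> 0 | Suc k \<Rightarrow> exp_coeff w k L))
        = \<zeta> * (\<Sum>n<N. \<zeta> ^ n * exp_coeff w n L)"
      by (simp add: sum.lessThan_Suc_shift sum_distrib_left mult.assoc del: sum.lessThan_Suc)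
    finally show ?thesis
      unfolding exp_remainder_def[of _ _ _ L] sum_distrib_left[symmetric]
      by (simp add: algebra_simps del: sum.lessThan_Suc)
  qed
  have K: "q ^ Suc N * (norm w + r + 1) * V (exp L)
      = norm w * (q ^ Suc N * V (exp L)) + norm \<zeta> * (q ^ N * V (exp L)) + q ^ Suc N * V (exp L)" for L
    by (simp add: q(3) algebra_simps)
  have nn: "0 \<le> q ^ n * V (exp L)" for n L using q V by simp
  have "norm (exp_remainder w \<zeta> (Suc N) L) \<le> q ^ Suc N * (norm w + r + 1) * V (exp L)" for L
    unfolding K using le[of "Suc N" L] nn by (smt (verit) mult_nonneg_nonneg norm_ge_zero)
  moreover have "norm (w * exp_remainder w \<zeta> (Suc N) L + \<zeta> * exp_remainder w \<zeta> N L)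
      \<le> q ^ Suc N * (norm w + r + 1) * V (exp L)" for L
  proof -
    have "norm (w * exp_remainder w \<zeta> (Suc N) L) \<le> norm w * (q ^ Suc N * V (exp L))"
      "norm (\<zeta> * exp_remainder w \<zeta> N L) \<le> norm \<zeta> * (q ^ N * V (exp L))"
      unfolding norm_mult by (intro mult_left_mono le norm_ge_zero)+
    then show ?thesis
      unfolding K using nn[of "Suc N" L] by (intro norm_triangle_le) linarith
  qed
  ultimately show ?thesis
    unfolding V_def[symmetric] q_def[symmetric]
    using q r by (intro kernel_boundI[OF _ _ deriv]) auto
qed

section \<open>The power series of \<open>\<Gamma>\<^sub>z\<close>\<close>

text \<open>The factor \<open>\<parallel>v x\<parallel>\<^sup>2 = exp (2 L)\<close> is what shifts the exponent \<open>z\<close> to \<open>2 + z\<close>.\<close>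

lemma Gamma_integrand_eq:
  fixes f :: "'k::finite proj \<Rightarrow> complex"
  shows "Gamma_integrand z f p = kernel_integrand (exp_coeff (2 + z) 0) f p"
proof
  fix v :: "complex ^ 'k ^ 'k"
  let ?t = "norm (v *v unit_rep p)"
  show "Gamma_integrand z f p v = kernel_integrand (exp_coeff (2 + z) 0) f p v"
  proof (cases "v *v unit_rep p = 0")
    case False
    then have "complex_of_real (?t\<^sup>2) = exp (2 * complex_of_real (ln ?t))"
      by (simp add: exp_double exp_of_real)
    then show ?thesis using False
      by (simp add: Gamma_integrand_def kernel_integrand_def exp_coeff_def exp_add distrib_right mult_ac)
  qed (simp add: Gamma_integrand_def kernel_integrand_def)
qed

lemma Gamma_op_eq: "Gamma_op \<mu> z = kernel_op \<mu> (exp_coeff (2 + z) 0)"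
  by (simp add: fun_eq_iff Gamma_op_def kernel_op_def Gamma_integrand_eq)

theorem theorem3p4:
  fixes \<mu> :: "(complex ^ 'k::finite ^ 'k) measure" and \<tau> \<delta> \<alpha> :: real
  assumes borel: "sets \<mu> = sets borel"
    and second_moment: "integrable \<mu> (\<lambda>v. (opnorm_mat v)\<^sup>2)"
    and stochastic: "(LINT v|\<mu>. cadj v ** v) = mat 1"
    and Pur: "Pur \<mu>"
    and Erg: "Erg \<mu>"
    and \<tau>: "0 < \<tau>" "\<tau> < 2"
    and \<delta>: "0 < \<delta>"
    and moments: "integrable \<mu> (\<lambda>v. opnorm_mat v powr (2 - \<tau>) + opnorm_mat v powr (2 + \<delta>))"
    and \<alpha>: "\<alpha> = 1 - \<tau> / 2"
  shows "(\<forall>z. - \<tau> < Re z \<and> Re z < \<delta> \<longrightarrow>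
            (\<forall>f\<in>holder_space \<alpha>. \<forall>p. integrable \<mu> (Gamma_integrand z f p)) \<and>
            bounded_endo \<alpha> (Gamma_op \<mu> z)) \<and>
         analytic_endo_on \<alpha> (Gamma_op \<mu>) {z. - \<tau> < Re z \<and> Re z < \<delta>}"
proof -
  let ?W = "power_weight (2 - \<tau>) (2 + \<delta>)"
  let ?S = "{z. - \<tau> < Re z \<and> Re z < \<delta>}"
  interpret weighted_measure \<mu> \<alpha> ?W
  proof
    show "holder_weight \<alpha> ?W" using \<alpha> \<tau> \<delta> by (intro holder_weight_power_weight) auto
  qed (use borel \<alpha> \<tau> moments in \<open>simp_all add: power_weight_def\<close>)
  have radius: "\<exists>r>0. 2 - \<tau> \<le> Re (2 + z) - r \<and> Re (2 + z) + r \<le> 2 + \<delta>" if "z \<in> ?S" for z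
    \<comment> \<open>The distance from \<open>z\<close> to the boundary of the strip: the power series at \<open>z\<close> converges in
      the largest disc contained in the strip.\<close>
    using that by (intro exI[of _ "min (Re z + \<tau>) (\<delta> - Re z)"]) auto
  have kernel: "\<exists>K. kernel_bound ?W K (exp_coeff (2 + z) n)" if "z \<in> ?S" for z n
    using radius[OF that] kernel_bound_exp_coeff by blast
  have endo: "bounded_endo \<alpha> (kernel_op \<mu> (exp_coeff (2 + z) n))" if "z \<in> ?S" for z n
    using kernel[OF that, of n] bounded_endo_kernel_op by blast
  have "analytic_endo_on \<alpha> (Gamma_op \<mu>) ?S"
    unfolding analytic_endo_on_def
  proof (intro conjI ballI)
    fix z assume z: "z \<in> ?S"
    show "bounded_endo \<alpha> (Gamma_op \<mu> z)" unfolding Gamma_op_eq by (rule endo[OF z])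
    obtain r where r: "0 < r" "2 - \<tau> \<le> Re (2 + z) - r" "Re (2 + z) + r \<le> 2 + \<delta>"
      using radius[OF z] by blast
    show "\<exists>r>0. ball z r \<subseteq> ?S \<and>
       (\<exists>A :: nat \<Rightarrow> 'k fun_op. (\<forall>n. bounded_endo \<alpha> (A n)) \<and>
         (\<forall>z'\<in>ball z r.
           (\<lambda>N. endo_norm \<alpha> (\<lambda>f p. Gamma_op \<mu> z' f p - (\<Sum>n<N. (z' - z) ^ n * A n f p))) \<longlonglongrightarrow> 0))"
    proof (intro exI[of _ r] conjI exI[of _ "\<lambda>n. kernel_op \<mu> (exp_coeff (2 + z) n)"] allI ballI)
      show ball: "ball z r \<subseteq> ?S"
      proof
        fix z' assume "z' \<in> ball z r"
        then have "\<bar>Re (z' - z)\<bar> < r"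
          using abs_Re_le_cmod[of "z' - z"] by (simp add: dist_norm norm_minus_commute)
        then show "z' \<in> ?S" using r by auto
      qed
      fix z' assume z': "z' \<in> ball z r"
      define \<zeta> where "\<zeta> = z' - z"
      have \<zeta>: "norm \<zeta> < r" using z' by (simp add: \<zeta>_def dist_norm norm_minus_commute)
      let ?T = "\<lambda>N f p. Gamma_op \<mu> z' f p - (\<Sum>n<N. \<zeta> ^ n * kernel_op \<mu> (exp_coeff (2 + z) n) f p)"
      have eq: "?T N f = kernel_op \<mu> (exp_remainder (2 + z) \<zeta> N) f"
        if f: "f \<in> holder_space \<alpha>" for f :: "'k proj \<Rightarrow> complex" and N
      proof
        fix p
        have "z' \<in> ?S" using ball z' by blast
        then have "integrable \<mu> (kernel_integrand (exp_coeff (2 + z') 0) f p)"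
          using kernel kernel_integrand_integrable[OF f] by blast
        moreover have "integrable \<mu> (kernel_integrand (exp_coeff (2 + z) n) f p)" for n
          using kernel[OF z] kernel_integrand_integrable[OF f] by blast
        ultimately have "?T N f p = (LINT v|\<mu>. kernel_integrand (exp_coeff (2 + z') 0) f p v
            - (\<Sum>n<N. \<zeta> ^ n * kernel_integrand (exp_coeff (2 + z) n) f p v))"
          by (simp add: Gamma_op_eq kernel_op_def)
        also have "(\<lambda>v. kernel_integrand (exp_coeff (2 + z') 0) f p v
              - (\<Sum>n<N. \<zeta> ^ n * kernel_integrand (exp_coeff (2 + z) n) f p v))
            = kernel_integrand (exp_remainder (2 + z) \<zeta> N) f p"
          by (simp add: fun_eq_iff kernel_integrand_def exp_remainder_def right_diff_distrib
              sum_distrib_left mult_ac)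
             (simp add: exp_coeff_def \<zeta>_def)
        finally show "?T N f p = kernel_op \<mu> (exp_remainder (2 + z) \<zeta> N) f p"
          by (simp add: kernel_op_def)
      qed
      define B where "B = (norm (2 + z) + r + 1) * weight_integral * (1 + 1 / \<alpha>)"
      \<comment> \<open>The remainder bound starts at order one, because the derivative involves the remainder of the
        preceding order; this does not affect the limit.\<close>
      have est: "0 \<le> endo_norm \<alpha> (?T (Suc N)) \<and> endo_norm \<alpha> (?T (Suc N)) \<le> (norm \<zeta> / r) ^ Suc N * B" for N
      proof -
        have "kernel_bound ?W ((norm \<zeta> / r) ^ Suc N * (norm (2 + z) + r + 1))
            (exp_remainder (2 + z) \<zeta> (Suc N))"
          using \<zeta> by (intro kernel_bound_exp_remainder r) auto
        from endo_norm_kernel_op_le[where T = "?T (Suc N)", OF eq this] show ?thesis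
          unfolding B_def by (simp only: mult.assoc simp_thms)
      qed
      have "(\<lambda>N. (norm \<zeta> / r) ^ N) \<longlonglongrightarrow> 0"
        using \<zeta> r by (intro LIMSEQ_power_zero) auto
      from tendsto_mult_left_zero[OF LIMSEQ_Suc[OF this]]
      have lim: "(\<lambda>N. (norm \<zeta> / r) ^ Suc N * B) \<longlonglongrightarrow> 0" .
      have "(\<lambda>N. endo_norm \<alpha> (?T (Suc N))) \<longlonglongrightarrow> 0"
        by (rule tendsto_sandwich[OF _ _ tendsto_const lim])
          (rule always_eventually, use est in blast)+
      then show "(\<lambda>N. endo_norm \<alpha> (\<lambda>f p. Gamma_op \<mu> z' f p
          - (\<Sum>n<N. (z' - z) ^ n * kernel_op \<mu> (exp_coeff (2 + z) n) f p))) \<longlonglongrightarrow> 0"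
        unfolding \<zeta>_def by (rule LIMSEQ_imp_Suc)
    qed (use r endo[OF z] in auto)
  qed
  moreover have "integrable \<mu> (Gamma_integrand z f p)" if "z \<in> ?S" "f \<in> holder_space \<alpha>" for z f p
    unfolding Gamma_integrand_eq using kernel[OF that(1)] kernel_integrand_integrable[OF that(2)] by blast
  ultimately show ?thesis unfolding analytic_endo_on_def by blast
qed

end
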